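(* Let $\mathcal{P}$ be a nilpotent Poisson algebra of dimension $n$ over an arbitrary field. If $\alpha(\mathcal{P})=n-2$, then $\beta(\mathcal{P})=n-2$. Moreover, if (in addition) $\alpha_A(\mathcal{P})=n-2$, then any abelian subalgebra of $\mathcal{P}$ of codimension two is an ideal of $\mathcal{P}$.
   Context: A Poisson algebra over a field $\mathbb{F}$ is an $\mathbb{F}$-vector space $\mathcal{P}$ with two bilinear multiplications, $\cdot$ (written by concatenation) and $[\cdot,\cdot]$, such that $\mathcal{P}_A:=(\mathcal{P},\cdot)$ is an associative commutative algebra (not necessarily unital), $\mathcal{P}_L:=(\mathcal{P},[\cdot,\cdot])$ is a Lie algebra, and $[xy,z]=[x,z]y+x[y,z]$ for all $x,y,z$. A subalgebra is a linear subspace closed under both multiplications; an ideal is a subspace $I$ with $I\cdot\mathcal{P}+[I,\mathcal{P}]\subseteq I$; a subalgebra or ideal $A$ is abelian if $A\cdot A+[A,A]=0$. $\alpha(\mathcal{P})$ (resp. $\beta(\mathcal{P})$) is the maximal dimension of an abelian subalgebra (resp. abelian ideal) of $\mathcal{P}$; $\alpha_A(\mathcal{P})$ is the maximal dimension of an abelian subalgebra of $\mathcal{P}_A$, i.e. of a subspace $A$ with $A\cdot A=0$. The lower central series is $\mathcal{P}^{(1)}=\mathcal{P}$, $\mathcal{P}^{(k+1)}=\sum_{i=1}^{k}\big(\mathcal{P}^{(i)}\cdot\mathcal{P}^{(k+1-i)}+[\mathcal{P}^{(i)},\mathcal{P}^{(k+1-i)}]\big)$ (for Poisson algebras this equals $\mathcal{P}^{(k)}\cdot\mathcal{P}+[\mathcal{P}^{(k)},\mathcal{P}]$);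 $\mathcal{P}$ is nilpotent if $\mathcal{P}^{(m)}=0$ for some $m$. *)

theory Defs
  imports Complex_Main
begin

text \<open>
  The underlying vector space is the whole type \<open>'a\<close>, over an arbitrary field \<open>'k\<close>.
  The commutative associative product need not have a unit.  The Lie bracket is required to be
  alternating, not merely antisymmetric, since characteristic 2 is allowed.
\<close>

locale poisson_algebra = vector_space scale
  for scale :: "'k::field \<Rightarrow> 'a::ab_group_add \<Rightarrow> 'a" +
  fixes mult :: "'a \<Rightarrow> 'a \<Rightarrow> 'a"
    and bracket :: "'a \<Rightarrow> 'a \<Rightarrow> 'a"
  assumes mult_linear_left: "Vector_Spaces.linear scale scale (\<lambda>x. mult x y)"
    and mult_linear_right: "Vector_Spaces.linear scale scale (\<lambda>y. mult x y)"
    and mult_assoc: "mult (mult x y) z = mult x (mult y z)"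
    and mult_commute: "mult x y = mult y x"
    and bracket_linear_left: "Vector_Spaces.linear scale scale (\<lambda>x. bracket x y)"
    and bracket_linear_right: "Vector_Spaces.linear scale scale (\<lambda>y. bracket x y)"
    and bracket_alternating: "bracket x x = 0"
    and bracket_jacobi:
      "bracket x (bracket y z) + bracket y (bracket z x) + bracket z (bracket x y) = 0"
    and leibniz: "bracket (mult x y) z = mult (bracket x z) y + mult x (bracket y z)"
begin

definition subalgebra :: "'a set \<Rightarrow> bool" where
  "subalgebra A \<longleftrightarrow> subspace A \<and> (\<forall>x\<in>A. \<forall>y\<in>A. mult x y \<in> A \<and> bracket x y \<in> A)"

definition ideal :: "'a set \<Rightarrow> bool" where
  "ideal I \<longleftrightarrow> subspace I \<and> (\<forall>x\<in>I. \<forall>y. mult x y \<in> I \<and> bracket x y \<in> I)"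

definition abelian :: "'a set \<Rightarrow> bool" where
  "abelian A \<longleftrightarrow> (\<forall>x\<in>A. \<forall>y\<in>A. mult x y = 0 \<and> bracket x y = 0)"

text \<open>
  In finite dimension the sets below are finite and contain the dimension of the zero subspace,
  so each \<open>Max\<close> is a genuine maximum.  In infinite dimension the values carry no meaning.
\<close>

definition alpha :: nat where
  "alpha = Max {dim A | A. subalgebra A \<and> abelian A}"

definition beta :: nat where
  "beta = Max {dim I | I. ideal I \<and> abelian I}"

definition alpha_A :: nat where
  "alpha_A = Max {dim A | A. subspace A \<and> (\<forall>x\<in>A. \<forall>y\<in>A. mult x y = 0)}"

text \<open>
  The series is indexed from 1; the value at 0 is a dummy.  A product of subspaces is the span of
  the products of their elements, so one span of a union yields the sum of all the products.
\<close>

fun lower_central :: "nat \<Rightarrow> 'a set" where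
  "lower_central k =
    (if k \<le> 1 then UNIV
     else span (\<Union>i\<in>{1..<k}.
       {mult x y | x y. x \<in> lower_central i \<and> y \<in> lower_central (k - i)} \<union>
       {bracket x y | x y. x \<in> lower_central i \<and> y \<in> lower_central (k - i)}))"

declare lower_central.simps [simp del]

definition nilpotent :: bool where
  "nilpotent \<longleftrightarrow> (\<exists>m\<ge>1. lower_central m = {0})"

end

end

theory Submission
  imports Defs
begin

text \<open>
  Nilpotency puts an abelian subalgebra \<open>A\<close> of codimension two inside an ideal \<open>M\<close> of codimension
  one in which \<open>A\<close> is an ideal.  Let \<open>z \<notin> M\<close>.  If \<open>[z, A] \<subseteq> A\<close> but \<open>zA\<close> is not contained in
  \<open>A\<close>, then \<open>M\<close> is abelian, which the hypothesis on \<open>\<alpha>\<close> excludes.  If \<open>y = [z, a] \<notin> A\<close> for some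
  \<open>a \<in> A\<close>, then \<open>K = {k \<in> A. [z, k] \<in> A}\<close> has codimension one in \<open>A\<close> and annihilates \<open>M\<close>;
  moreover \<open>MM = 0\<close>, so \<open>[a, y] \<noteq> 0\<close> and \<open>K\<close> is exactly the annihilator of \<open>M\<close>, hence an ideal.
  By nilpotency some \<open>b \<in> M - K\<close> is annihilated modulo \<open>K\<close> by the whole algebra, and \<open>K + \<langle>b\<rangle>\<close>
  is an abelian ideal of codimension two.
\<close>

context poisson_algebra
begin

section \<open>Bilinearity, antisymmetry and the derivation rules\<close>

lemma module_hom_mult_left: "module_hom scale scale (\<lambda>x. mult x y)"
  using mult_linear_left by (simp add: linear_iff_module_hom)

lemma module_hom_mult_right: "module_hom scale scale (\<lambda>y. mult x y)"
  using mult_linear_right by (simp add: linear_iff_module_hom)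

lemma module_hom_bracket_left: "module_hom scale scale (\<lambda>x. bracket x y)"
  using bracket_linear_left by (simp add: linear_iff_module_hom)

lemma module_hom_bracket_right: "module_hom scale scale (\<lambda>y. bracket x y)"
  using bracket_linear_right by (simp add: linear_iff_module_hom)

lemmas product_simps [simp] =
  module_hom.add[OF module_hom_mult_left] module_hom.add[OF module_hom_mult_right]
  module_hom.add[OF module_hom_bracket_left] module_hom.add[OF module_hom_bracket_right]
  module_hom.diff[OF module_hom_mult_left] module_hom.diff[OF module_hom_mult_right]
  module_hom.diff[OF module_hom_bracket_left] module_hom.diff[OF module_hom_bracket_right]
  module_hom.scale[OF module_hom_mult_left] module_hom.scale[OF module_hom_mult_right]
  module_hom.scale[OF module_hom_bracket_left] module_hom.scale[OF module_hom_bracket_right]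
  module_hom.zero[OF module_hom_mult_left] module_hom.zero[OF module_hom_mult_right]
  module_hom.zero[OF module_hom_bracket_left] module_hom.zero[OF module_hom_bracket_right]
  bracket_alternating

lemma bracket_antisym: "bracket x y = - bracket y x"
proof -
  have "bracket (x + y) (x + y) = 0"
    by (rule bracket_alternating)
  then have "bracket x y + bracket y x = 0"
    by (simp del: bracket_alternating add: bracket_alternating[of x] bracket_alternating[of y] add.commute)
  then show ?thesis
    by (simp add: eq_neg_iff_add_eq_0)
qed

lemma bracket_eq_0_commute: "bracket x y = 0 \<longleftrightarrow> bracket y x = 0"
  using bracket_antisym[of x y] by simp

lemma bracket_mem_commute:
  assumes "subspace S"
  shows "bracket x y \<in> S \<longleftrightarrow> bracket y x \<in> S"
  using bracket_antisym[of x y] bracket_antisym[of y x] subspace_neg[OF assms] by metis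

lemma leibniz_right: "bracket z (mult x y) = mult (bracket z x) y + mult x (bracket z y)"
proof -
  have "bracket z (mult x y) = - bracket (mult x y) z"
    by (rule bracket_antisym)
  also have "\<dots> = - mult (bracket x z) y - mult x (bracket y z)"
    by (simp add: leibniz)
  also have "\<dots> = mult (- bracket x z) y + mult x (- bracket y z)"
    using module_hom.neg[OF module_hom_mult_left] module_hom.neg[OF module_hom_mult_right] by simp
  also have "\<dots> = mult (bracket z x) y + mult x (bracket z y)"
    by (simp only: bracket_antisym[symmetric])
  finally show ?thesis .
qed

lemma bracket_derivation:
  "bracket z (bracket x y) = bracket (bracket z x) y + bracket x (bracket z y)"
proof -
  have "bracket z (bracket x y) = - bracket x (bracket y z) - bracket y (bracket z x)"
    using bracket_jacobi[of z x y] by (simp add: algebra_simps eq_neg_iff_add_eq_0)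
  moreover have "- bracket x (bracket y z) = bracket x (bracket z y)"
    using bracket_antisym[of y z] module_hom.neg[OF module_hom_bracket_right] by simp
  moreover have "- bracket y (bracket z x) = bracket (bracket z x) y"
    using bracket_antisym[of "bracket z x" y] by simp
  ultimately show ?thesis
    by (metis add.commute diff_conv_add_uminus)
qed

section \<open>The lower central series\<close>

lemma lower_central_1: "lower_central (Suc 0) = UNIV"
  by (subst lower_central.simps) simp

lemma lower_central_Suc:
  assumes "k \<ge> 1" "x \<in> lower_central k"
  shows "mult x p \<in> lower_central (Suc k)" "bracket x p \<in> lower_central (Suc k)"
proof -
  have p: "p \<in> lower_central (Suc k - k)"
    by (simp add: lower_central_1)
  have k: "k \<in> {1..<Suc k}" "\<not> Suc k \<le> 1"
    using assms(1) by auto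
  show "mult x p \<in> lower_central (Suc k)" "bracket x p \<in> lower_central (Suc k)"
    unfolding lower_central.simps[of "Suc k"] if_not_P[OF k(2)] using k(1) p assms(2)
    by (intro span_base; blast)+
qed

text \<open>This plays the part of Engel's theorem. The intersections of \<open>S\<close> with the
  terms of the series start at \<open>S\<close>, outside \<open>K\<close>, and end within zero, so
  some intersection not contained in \<open>K\<close> is followed by one that is. Multiplying an
  element of the former by anything lands in the latter.\<close>

lemma nilpotent_annihilated_modulo:
  assumes nilpotent and "0 \<in> K" and "\<not> S \<subseteq> K"
    and S: "\<And>x p. x \<in> S \<Longrightarrow> mult x p \<in> S \<and> bracket x p \<in> S"
  shows "\<exists>x\<in>S. x \<notin> K \<and> (\<forall>p. mult x p \<in> K \<and> bracket x p \<in> K)"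
proof -
  obtain m where m: "m \<ge> 1" "lower_central m = {0}"
    using assms(1) unfolding nilpotent_def by blast
  \<comment> \<open>The shift by \<open>Suc\<close> matches the indexing of the series from 1; the
    vanishing term \<open>m\<close> is thus reached at \<open>m - 1\<close>.\<close>
  let ?P = "\<lambda>k. S \<inter> lower_central (Suc k) \<subseteq> K"
  have P: "?P (m - 1)"
    using m assms(2) by auto
  have "\<not> ?P 0"
    using assms(3) by (simp add: lower_central_1)
  have "\<exists>k. \<not> ?P k \<and> ?P (Suc k)"
  proof (rule ccontr)
    assume *: "\<nexists>k. \<not> ?P k \<and> ?P (Suc k)"
    have "\<not> ?P k" for k
      using \<open>\<not> ?P 0\<close> * by (induction k) blast+
    then show False
      using P by blast
  qed
  then obtain k where k: "\<not> ?P k" "?P (Suc k)"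
    by blast
  then obtain x where x: "x \<in> S" "x \<in> lower_central (Suc k)" "x \<notin> K"
    by blast
  have "mult x p \<in> K \<and> bracket x p \<in> K" for p
    using k(2) S[OF x(1), of p] lower_central_Suc[of "Suc k" x p] x(2) by auto
  then show ?thesis
    using x by blast
qed

section \<open>Adjoining one vector to a subspace\<close>

lemma span_insertD:
  assumes "subspace A" "u \<in> span (insert x A)"
  shows "\<exists>c. u - scale c x \<in> A"
  using assms by (auto simp: span_insert span_eq_iff[THEN iffD2])

lemma in_span_insertE:
  assumes "subspace A" "u \<in> span (insert x A)"
  obtains a c where "a \<in> A" "u = a + scale c x"
proof -
  obtain c where "u - scale c x \<in> A"
    using span_insertD[OF assms] by blast
  then show ?thesis
    using that[of "u - scale c x" c] by simp
qed

lemma mult_span_insert_eq_0: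
  assumes "subspace A" "\<And>a b. a \<in> A \<Longrightarrow> b \<in> A \<Longrightarrow> mult a b = 0"
    and "\<And>a. a \<in> A \<Longrightarrow> mult x a = 0" "mult x x = 0"
    and "u \<in> span (insert x A)" "v \<in> span (insert x A)"
  shows "mult u v = 0"
proof -
  obtain a c b d where "a \<in> A" "u = a + scale c x" "b \<in> A" "v = b + scale d x"
    by (rule in_span_insertE[OF assms(1,5)], rule in_span_insertE[OF assms(1,6)])
  then show ?thesis
    using assms(2,3,4) mult_commute[of a x] by simp
qed

lemma bracket_span_insert_eq_0:
  assumes "subspace A" "\<And>a b. a \<in> A \<Longrightarrow> b \<in> A \<Longrightarrow> bracket a b = 0"
    and "\<And>a. a \<in> A \<Longrightarrow> bracket x a = 0"
    and "u \<in> span (insert x A)" "v \<in> span (insert x A)"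
  shows "bracket u v = 0"
proof -
  obtain a c b d where "a \<in> A" "u = a + scale c x" "b \<in> A" "v = b + scale d x"
    by (rule in_span_insertE[OF assms(1,4)], rule in_span_insertE[OF assms(1,5)])
  then show ?thesis
    using assms(2,3) bracket_eq_0_commute[of a x] by simp
qed

section \<open>Ideals and annihilators\<close>

lemma ideal_subspace: "ideal I \<Longrightarrow> subspace I"
  by (simp add: ideal_def)

lemma ideal_mult_left: "ideal I \<Longrightarrow> x \<in> I \<Longrightarrow> mult p x \<in> I"
  using mult_commute[of p x] by (simp add: ideal_def)

lemma ideal_bracket_left: "ideal I \<Longrightarrow> x \<in> I \<Longrightarrow> bracket p x \<in> I"
  using bracket_mem_commute[of I p x] by (simp add: ideal_def)

lemma ideal_span_insert:
  assumes "ideal K" "\<And>p. mult b p \<in> K" "\<And>p. bracket b p \<in> K"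
  shows "ideal (span (insert b K))"
  unfolding ideal_def
proof (intro conjI ballI allI)
  note K = ideal_subspace[OF assms(1)]
  fix x p assume "x \<in> span (insert b K)"
  then obtain c where c: "x - scale c b \<in> K"
    using span_insertD[OF K] by blast
  have "mult (x - scale c b) p + scale c (mult b p) \<in> K"
    "bracket (x - scale c b) p + scale c (bracket b p) \<in> K"
    using assms c K unfolding ideal_def by (meson subspace_add subspace_scale)+
  then have "mult x p \<in> K" "bracket x p \<in> K"
    by simp_all
  then show "mult x p \<in> span (insert b K)" "bracket x p \<in> span (insert b K)"
    by (auto intro: span_base)
qed simp

text \<open>For \<open>mult x p\<close>, associativity and the Leibniz rule move \<open>p\<close>
  onto \<open>m\<close>, and \<open>M\<close> absorbs it. For \<open>bracket p x\<close>, apply the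
  derivation \<open>bracket p\<close> to the vanishing products of \<open>x\<close> and
  \<open>m\<close>.\<close>

lemma ideal_annihilator:
  assumes "ideal M"
  shows "ideal {x \<in> M. \<forall>m\<in>M. mult x m = 0 \<and> bracket x m = 0}" (is "ideal ?Z")
  unfolding ideal_def
proof (intro conjI ballI allI)
  show Z: "subspace ?Z"
    using ideal_subspace[OF assms] by (auto simp: subspace_def)
  fix x p assume x: "x \<in> ?Z"
  have "mult (mult x p) m = 0 \<and> bracket (mult x p) m = 0" if "m \<in> M" for m
    using x that ideal_mult_left[OF assms that] ideal_bracket_left[OF assms that]
    by (simp add: mult_assoc leibniz)
  then show "mult x p \<in> ?Z"
    using x assms by (simp add: ideal_def)
  have "mult (bracket p x) m = 0 \<and> bracket (bracket p x) m = 0" if "m \<in> M" for m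
    using x that ideal_bracket_left[OF assms that]
      leibniz_right[of p x m] bracket_derivation[of p x m] by simp
  moreover have "bracket p x \<in> M"
    using x ideal_bracket_left[OF assms] by simp
  ultimately have "bracket p x \<in> ?Z"
    by simp
  then show "bracket x p \<in> ?Z"
    using bracket_mem_commute[OF Z] by blast
qed

end

section \<open>Abelian subalgebras of codimension two that are not ideals\<close>

locale finite_dimensional_poisson_algebra =
  poisson_algebra scale mult bracket + finite_dimensional_vector_space scale Basis
  for scale :: "'k::field \<Rightarrow> 'a::ab_group_add \<Rightarrow> 'a" and mult bracket Basis
begin

lemma subspace_eq_span_insert:
  assumes "subspace A" "subspace M" "A \<subseteq> M" "dim M = Suc (dim A)" "y \<in> M" "y \<notin> A"
  shows "M = span (insert y A)"
proof (rule subspace_dim_equal[symmetric])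
  show "span (insert y A) \<subseteq> M"
    using assms by (intro span_minimal) auto
  have "y \<notin> span A"
    using assms(1,6) by (simp add: span_eq_iff[THEN iffD2])
  then show "dim M \<le> dim (span (insert y A))"
    using assms(4) by (simp add: dim_insert)
qed (use assms in auto)

lemma dim_span_insert:
  assumes "subspace A" "y \<notin> A"
  shows "dim (span (insert y A)) = Suc (dim A)"
  using assms by (simp add: dim_insert span_eq_iff[THEN iffD2])

text \<open>Serves both claims: \<open>B\<close> replaces \<open>A\<close> as an abelian ideal,
  while \<open>M\<close> is a subspace with zero product too large for the hypothesis on
  \<open>alpha_A\<close>. Maximality ranges over subspaces, since an abelian subspace is
  automatically a subalgebra.\<close>

lemma codim_two_abelian:
  assumes nilpotent and A: "subspace A" "abelian A" and dimA: "dim A + 2 = dim UNIV"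
    and maximal: "\<And>B. subspace B \<Longrightarrow> abelian B \<Longrightarrow> dim B \<le> dim A"
    and "\<not> ideal A"
  obtains M B where
    "subspace M" "dim M = Suc (dim A)" "\<And>u v. u \<in> M \<Longrightarrow> v \<in> M \<Longrightarrow> mult u v = 0"
    "ideal B" "abelian B" "dim B = dim A"
proof -
  have A0: "mult a b = 0" "bracket a b = 0" if "a \<in> A" "b \<in> A" for a b
    using A(2) that by (auto simp: abelian_def)
  have "\<not> UNIV \<subseteq> A"
    using dimA by (auto dest: top.extremum_uniqueI simp del: dim_UNIV)
  obtain w where w: "w \<notin> A" "\<And>p. mult w p \<in> A" "\<And>p. bracket w p \<in> A"
    using nilpotent_annihilated_modulo[OF assms(1) subspace_0[OF A(1)] \<open>\<not> UNIV \<subseteq> A\<close>] by auto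
  define M where "M = span (insert w A)"
  have M: "subspace M" "A \<subseteq> M" "dim M = Suc (dim A)"
    using dim_span_insert[OF A(1) w(1)] by (auto simp: M_def intro: span_base)
  \<comment> \<open>\<open>A\<close> is an ideal of \<open>M\<close>, because \<open>w\<close> sends
    everything into \<open>A\<close>.\<close>
  have MA: "mult m a \<in> A" "bracket m a \<in> A" if m: "m \<in> M" and a: "a \<in> A" for m a
  proof -
    obtain c where c: "m - scale c w \<in> A"
      using span_insertD[OF A(1)] m unfolding M_def by blast
    have "mult (m - scale c w) a + scale c (mult w a) \<in> A"
      "bracket (m - scale c w) a + scale c (bracket w a) \<in> A"
      using A0[OF c a] w A(1) by (simp_all only: add_0 subspace_scale)
    then show "mult m a \<in> A" "bracket m a \<in> A"
      by simp_all
  qed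
  have "\<not> UNIV \<subseteq> M"
    using dimA M(3) by (auto dest: top.extremum_uniqueI simp del: dim_UNIV)
  obtain z where z: "z \<notin> M" "\<And>p. mult z p \<in> M" "\<And>p. bracket z p \<in> M"
    using nilpotent_annihilated_modulo[OF assms(1) subspace_0[OF M(1)] \<open>\<not> UNIV \<subseteq> M\<close>] by auto
  \<comment> \<open>\<open>M\<close> has codimension one, so \<open>M\<close> and \<open>z\<close>
    span the whole space.\<close>
  have P: "\<exists>c. p - scale c z \<in> M" for p
    using subspace_eq_span_insert[OF M(1) subspace_UNIV, of z] dimA M(3) z(1)
      span_insertD[OF M(1), of p z] by simp
  have "ideal M"
    unfolding ideal_def
  proof (intro conjI ballI allI)
    fix x p assume x: "x \<in> M"
    obtain c where c: "p - scale c z \<in> M"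
      using P by blast
    obtain d where d: "x - scale d w \<in> A"
      using span_insertD[OF A(1)] x unfolding M_def by blast
    \<comment> \<open>Products of two elements of \<open>M\<close> even fall into \<open>A\<close>;
      only those with \<open>z\<close> remain to be treated.\<close>
    have *: "mult x q \<in> M" "bracket x q \<in> M" if "q \<in> M" for q
    proof -
      have "mult q (x - scale d w) + scale d (mult w q) \<in> A"
        "bracket q (x - scale d w) - scale d (bracket w q) \<in> A"
        using MA[OF that d] w A(1) by (meson subspace_add subspace_diff subspace_scale)+
      then have "mult q x \<in> A" "bracket q x \<in> A"
        using mult_commute[of q w] bracket_antisym[of q w] by simp_all
      then show "mult x q \<in> M" "bracket x q \<in> M"
        using M(2) mult_commute[of q x] bracket_mem_commute[OF M(1)] by auto
    qed
    have "mult x (p - scale c z) + scale c (mult z x) \<in> M"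
      "bracket x (p - scale c z) - scale c (bracket z x) \<in> M"
      using *[OF c] z M(1) by (meson subspace_add subspace_diff subspace_scale)+
    then show "mult x p \<in> M" "bracket x p \<in> M"
      using mult_commute[of z x] bracket_antisym[of z x] by simp_all
  qed (rule M)
  have not_abelian: "\<not> abelian M"
    using maximal[OF M(1)] M(3) by auto
  have M_span: "M = span (insert y A)" if "y \<in> M" "y \<notin> A" for y
    using subspace_eq_span_insert[OF A(1) M] that by blast
  have "\<exists>a\<in>A. bracket z a \<notin> A"
  proof (rule ccontr)
    assume "\<not> ?thesis"
    then have zA: "bracket z a \<in> A" if "a \<in> A" for a
      using that by blast
    \<comment> \<open>Otherwise \<open>A\<close> would absorb products with both \<open>M\<close>
      and \<open>z\<close>, hence be an ideal.\<close>
    have "\<exists>a\<in>A. mult z a \<notin> A"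
    proof (rule ccontr)
      assume "\<not> ?thesis"
      then have zA': "mult z a \<in> A" if "a \<in> A" for a
        using that by blast
      have "mult a p \<in> A \<and> bracket a p \<in> A" if a: "a \<in> A" for a p
      proof -
        obtain c where c: "p - scale c z \<in> M"
          using P by blast
        have "mult (p - scale c z) a + scale c (mult z a) \<in> A"
          "bracket (p - scale c z) a + scale c (bracket z a) \<in> A"
          using MA[OF c a] zA[OF a] zA'[OF a] A(1) by (meson subspace_add subspace_scale)+
        then show ?thesis
          using mult_commute[of p a] bracket_mem_commute[OF A(1), of p a] by simp
      qed
      then show False
        using \<open>\<not> ideal A\<close> A(1) by (simp add: ideal_def)
    qed
    then obtain a where a: "a \<in> A" "mult z a \<notin> A"
      by blast
    \<comment> \<open>The vector \<open>mult z a\<close> can replace \<open>w\<close> as generator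
      of \<open>M\<close> over \<open>A\<close>. It squares to zero and annihilates
      \<open>A\<close>, the bracket part using that \<open>bracket z b\<close> is in
      \<open>A\<close>; so \<open>M\<close> would be abelian.\<close>
    have ya: "mult (mult z a) b = 0" if "b \<in> A" for b
      using A0[OF a(1) that] by (simp add: mult_assoc)
    have "mult (mult z a) (mult z a) = mult z (mult a (mult z a))"
      by (rule mult_assoc)
    also have "mult a (mult z a) = mult (mult z a) a"
      by (rule mult_commute)
    finally have yy: "mult (mult z a) (mult z a) = 0"
      using ya[OF a(1)] by simp
    have yb: "bracket (mult z a) b = 0" if b: "b \<in> A" for b
    proof -
      have "bracket z b \<in> A" by (rule zA[OF b])
      then show ?thesis
        using A0 a(1) b by (simp add: leibniz)
    qed
    have "abelian (span (insert (mult z a) A))"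
      unfolding abelian_def
      using mult_span_insert_eq_0[OF A(1) A0(1) ya yy] bracket_span_insert_eq_0[OF A(1) A0(2) yb]
      by blast
    then show False
      using not_abelian M_span[OF z(2) a(2)] by simp
  qed
  then obtain a where a: "a \<in> A" "bracket z a \<notin> A"
    by blast
  define y where "y = bracket z a"
  have y: "y \<in> M" "y \<notin> A"
    using a z by (auto simp: y_def)
  \<comment> \<open>\<open>K\<close> is the kernel of the map from \<open>A\<close> to the line
    \<open>M/A\<close> induced by \<open>bracket z\<close>. As \<open>a\<close> is not in it, its
    codimension in \<open>A\<close> is one.\<close>
  define K where "K = {k \<in> A. bracket z k \<in> A}"
  have K: "subspace K" "K \<subseteq> A"
    using A(1) by (auto simp: K_def subspace_def)
  have aK: "a \<notin> K"
    using a by (simp add: K_def)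
  have A_span: "A = span (insert a K)"
  proof
    show "span (insert a K) \<subseteq> A"
      using a K A(1) by (intro span_minimal) auto
    show "A \<subseteq> span (insert a K)"
    proof
      fix b assume b: "b \<in> A"
      obtain c where "bracket z b - scale c y \<in> A"
        using span_insertD[OF A(1)] z(3) M_span[OF y] by blast
      then have "b - scale c a \<in> K"
        using b a A(1) by (auto simp: K_def y_def subspace_diff subspace_scale)
      then show "b \<in> span (insert a K)"
        by (auto simp: span_insert intro: span_base)
    qed
  qed
  have M_expand: "\<exists>k\<in>K. \<exists>c d. m = k + scale c a + scale d y" if m: "m \<in> M" for m
  proof -
    obtain b d where "b \<in> A" "m = b + scale d y"
      using in_span_insertE[OF A(1)] m M_span[OF y] by metis
    moreover obtain k c where "k \<in> K" "b = k + scale c a"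
      using in_span_insertE[OF K(1)] \<open>b \<in> A\<close> A_span by metis
    ultimately show ?thesis
      by blast
  qed
  \<comment> \<open>Apply the derivation \<open>bracket z\<close> to the zero products of
    \<open>k\<close> and \<open>a\<close>: the terms with \<open>bracket z k\<close> vanish because
    it lies in \<open>A\<close>.\<close>
  have Ky: "mult k y = 0 \<and> bracket k y = 0" if k: "k \<in> K" for k
  proof -
    have "k \<in> A" "bracket z k \<in> A"
      using k by (auto simp: K_def)
    then show ?thesis
      using leibniz_right[of z k a] bracket_derivation[of z k a] A0 a(1) by (simp add: y_def)
  qed
  have KA: "mult k b = 0 \<and> bracket k b = 0" if "k \<in> K" "b \<in> A" for k b
    using that K(2) A0 by blast
  have KM: "mult k m = 0 \<and> bracket k m = 0" if k: "k \<in> K" and "m \<in> M" for k m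
    using M_expand[OF that(2)] Ky[OF k] KA[OF k] KA[OF k a(1)] K(2) by auto
  have aa: "mult a a = 0"
    using A0 a by blast
  \<comment> \<open>Expand \<open>mult z a\<close> with coefficient \<open>d\<close> at
    \<open>y\<close>. Its bracket with \<open>a\<close> gives \<open>ya = d[y,a]\<close>, its
    product with \<open>a\<close> gives \<open>d(ya) = 0\<close>. Either \<open>d\<close> or
    \<open>ya\<close> is zero, and both cases give \<open>ya = 0\<close>.\<close>
  have ya: "mult y a = 0"
  proof -
    obtain k c d where k: "k \<in> K" and za: "mult z a = k + scale c a + scale d y"
      using M_expand[OF z(2)] by blast
    have "mult y a = bracket (mult z a) a"
      by (simp add: leibniz y_def)
    also have "\<dots> = scale d (bracket y a)"
      using KA[OF k a(1)] by (simp add: za)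
    finally have 1: "mult y a = scale d (bracket y a)" .
    have "0 = mult (mult z a) a"
      by (simp add: mult_assoc aa)
    also have "\<dots> = scale d (mult y a)"
      using KA[OF k a(1)] by (simp add: za aa)
    finally show ?thesis
      using 1 by auto
  qed
  \<comment> \<open>Apply \<open>bracket z\<close> to \<open>ya = 0\<close>. Since
    \<open>bracket z y\<close> is in \<open>M\<close>, whose product with \<open>a\<close> is zero,
    only \<open>yy\<close> remains.\<close>
  have yy: "mult y y = 0"
  proof -
    obtain k c d where k: "k \<in> K" and zy: "bracket z y = k + scale c a + scale d y"
      using M_expand[OF z(3)] by blast
    have "0 = mult (bracket z y) a + mult y (bracket z a)"
      using leibniz_right[of z y a] ya by simp
    moreover have "mult (bracket z y) a = 0"
      using KA[OF k a(1)] by (simp add: zy aa ya)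
    ultimately show ?thesis
      by (simp add: y_def)
  qed
  have yA: "mult y b = 0" if b: "b \<in> A" for b
  proof -
    obtain c where "b - scale c a \<in> K"
      using span_insertD[OF K(1)] b A_span by blast
    then have "mult (b - scale c a) y = 0"
      using Ky by blast
    then show ?thesis
      using ya mult_commute[of y] by simp
  qed
  have MM: "mult u v = 0" if "u \<in> M" "v \<in> M" for u v
    using mult_span_insert_eq_0[OF A(1) A0(1) yA yy] that M_span[OF y] by blast
  \<comment> \<open>If it were zero, \<open>y\<close> would commute with \<open>K\<close> and
    \<open>a\<close>, hence with \<open>A\<close>, and \<open>M\<close> would be abelian.\<close>
  have e: "bracket a y \<noteq> 0"
  proof
    assume ay: "bracket a y = 0"
    have "bracket y b = 0" if b: "b \<in> A" for b
    proof -
      obtain c where "b - scale c a \<in> K"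
        using span_insertD[OF K(1)] b A_span by blast
      then have "bracket (b - scale c a) y = 0"
        using Ky by blast
      then show ?thesis
        using ay bracket_eq_0_commute[of y b] by simp
    qed
    then have "bracket u v = 0" if "u \<in> M" "v \<in> M" for u v
      using bracket_span_insert_eq_0[OF A(1) A0(2)] that M_span[OF y] by blast
    then show False
      using MM not_abelian by (auto simp: abelian_def)
  qed
  have "K = {x \<in> M. \<forall>m\<in>M. mult x m = 0 \<and> bracket x m = 0}" (is "K = ?Z")
  proof
    show "K \<subseteq> ?Z"
      using KM K(2) M(2) by blast
    show "?Z \<subseteq> K"
    proof
      fix x assume x: "x \<in> ?Z"
      then obtain k c d where k: "k \<in> K" and xk: "x = k + scale c a + scale d y"
        using M_expand by blast
      \<comment> \<open>Bracketing with \<open>y\<close> isolates \<open>c\<close>, bracketing with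
        \<open>a\<close> isolates \<open>d\<close>; both must vanish by \<open>e\<close>.\<close>
      have "bracket x y = 0" "bracket x a = 0"
        using x y(1) a(1) M(2) by auto
      then have "scale c (bracket a y) = 0" "scale d (bracket y a) = 0"
        using KM[OF k] y(1) a(1) M(2) by (auto simp: xk)
      then show "x \<in> K"
        using e bracket_eq_0_commute[of a y] k xk by simp
    qed
  qed
  then have idK: "ideal K"
    using ideal_annihilator[OF \<open>ideal M\<close>] by simp
  have "\<not> M \<subseteq> K"
    using y K(2) by blast
  obtain b where b: "b \<in> M" "b \<notin> K" "\<And>p. mult b p \<in> K" "\<And>p. bracket b p \<in> K"
    using nilpotent_annihilated_modulo[OF assms(1) subspace_0[OF K(1)] \<open>\<not> M \<subseteq> K\<close>] \<open>ideal M\<close>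
    by (auto simp: ideal_def)
  define B where "B = span (insert b K)"
  have "dim A = Suc (dim K)"
    using dim_span_insert[OF K(1) aK] A_span by simp
  then have "dim B = dim A"
    using dim_span_insert[OF K(1) b(2)] by (simp add: B_def)
  moreover have "ideal B"
    unfolding B_def using ideal_span_insert idK b by blast
  \<comment> \<open>Products vanish because \<open>B\<close> lies in \<open>M\<close>; brackets
    vanish because \<open>K\<close> annihilates \<open>b\<close>.\<close>
  moreover have "abelian B"
  proof -
    have "B \<subseteq> M"
      unfolding B_def using b(1) K(2) M by (intro span_minimal) auto
    moreover have "bracket u v = 0" if "u \<in> B" "v \<in> B" for u v
    proof (rule bracket_span_insert_eq_0[OF K(1)])
      show "bracket b k = 0" if "k \<in> K" for k
        using KM[OF that b(1)] bracket_eq_0_commute[of b k] by simp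
    qed (use that KA K(2) in \<open>auto simp: B_def\<close>)
    ultimately show ?thesis
      using MM unfolding abelian_def by blast
  qed
  ultimately show ?thesis
    using that[OF M(1,3) MM] by blast
qed

section \<open>The maxima defining \<open>alpha\<close>, \<open>beta\<close> and
  \<open>alpha_A\<close>\<close>

lemma finite_dims: "finite {dim A | A. P A}"
  by (rule finite_subset[of _ "{..dim UNIV}"]) (use dim_subset[OF subset_UNIV] in auto)

lemma subspace_0_abelian: "subspace {0}" "ideal {0}" "subalgebra {0}" "abelian {0}"
  by (auto simp: subspace_def ideal_def subalgebra_def abelian_def)

lemma dim_le_alpha:
  assumes "subspace A" "abelian A"
  shows "dim A \<le> alpha"
  unfolding alpha_def
  using assms subspace_0[OF assms(1)]
  by (intro Max_ge finite_dims) (auto simp: subalgebra_def abelian_def)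

lemma dim_le_beta: "ideal I \<Longrightarrow> abelian I \<Longrightarrow> dim I \<le> beta"
  unfolding beta_def by (intro Max_ge finite_dims) auto

lemma dim_le_alpha_A:
  "subspace A \<Longrightarrow> (\<And>x y. x \<in> A \<Longrightarrow> y \<in> A \<Longrightarrow> mult x y = 0) \<Longrightarrow> dim A \<le> alpha_A"
  unfolding alpha_A_def by (intro Max_ge finite_dims) auto

lemma alpha_attained: obtains A where "subspace A" "abelian A" "dim A = alpha"
proof -
  have "alpha \<in> {dim A | A. subalgebra A \<and> abelian A}"
    unfolding alpha_def using subspace_0_abelian by (intro Max_in finite_dims) blast
  then show ?thesis
    using that by (auto simp: subalgebra_def)
qed

lemma beta_le_alpha: "beta \<le> alpha"
proof -
  have "beta \<in> {dim I | I. ideal I \<and> abelian I}"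
    unfolding beta_def using subspace_0_abelian by (intro Max_in finite_dims) blast
  then show ?thesis
    using dim_le_alpha by (auto simp: ideal_def)
qed

end

theorem theorem4p6:
  fixes scale :: "'k::field \<Rightarrow> 'a::ab_group_add \<Rightarrow> 'a"
    and mult bracket :: "'a \<Rightarrow> 'a \<Rightarrow> 'a"
    and Basis :: "'a set"
    and n :: nat
  assumes "poisson_algebra scale mult bracket"
    and "finite_dimensional_vector_space scale Basis"
    and "vector_space.dim scale (UNIV :: 'a set) = n"
    and "poisson_algebra.nilpotent scale mult bracket"
    and "poisson_algebra.alpha scale mult bracket + 2 = n"
  shows "poisson_algebra.beta scale mult bracket + 2 = n \<and>
    (poisson_algebra.alpha_A scale mult + 2 = n \<longrightarrow>
      (\<forall>A. poisson_algebra.subalgebra scale mult bracket A \<and>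
           poisson_algebra.abelian mult bracket A \<and>
           vector_space.dim scale A + 2 = n
        \<longrightarrow> poisson_algebra.ideal scale mult bracket A))"
proof -
  interpret finite_dimensional_poisson_algebra scale mult bracket Basis
    using assms(1,2) by (simp add: finite_dimensional_poisson_algebra_def)
  have n: "dim UNIV = alpha + 2"
    using assms(3,5) by simp
  \<comment> \<open>The reverse inequality is \<open>beta_le_alpha\<close>. If an abelian subalgebra
    of maximal dimension is not an ideal, \<open>B\<close> from \<open>codim_two_abelian\<close>
    takes its place.\<close>
  have "alpha \<le> beta"
  proof -
    obtain A where A: "subspace A" "abelian A" "dim A = alpha"
      by (rule alpha_attained)
    show ?thesis
    proof (cases "ideal A")
      case True
      then show ?thesis
        using A dim_le_beta by force
    next
      case False
      obtain B where "ideal B" "abelian B" "dim B = dim A"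
        using codim_two_abelian[OF assms(4) A(1,2) _ _ False] A(3) n dim_le_alpha by metis
      then show ?thesis
        using A(3) dim_le_beta by force
    qed
  qed
  moreover have "ideal A"
    if hyps: "alpha_A + 2 = n" "subalgebra A" "abelian A" "dim A + 2 = n" for A
  proof (rule ccontr)
    assume not_ideal: "\<not> ideal A"
    have A: "subspace A" "dim A = alpha"
      using hyps assms(5) by (auto simp: subalgebra_def)
    \<comment> \<open>This \<open>M\<close> has dimension \<open>n - 1\<close>, which exceeds
      \<open>alpha_A\<close>.\<close>
    obtain M where "subspace M" "dim M = Suc (dim A)"
      "\<And>u v. u \<in> M \<Longrightarrow> v \<in> M \<Longrightarrow> mult u v = 0"
      using codim_two_abelian[OF assms(4) A(1) hyps(3) _ _ not_ideal] A(2) n dim_le_alpha by metis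
    then show False
      using dim_le_alpha_A[of M] hyps(1,4) by simp
  qed
  ultimately show ?thesis
    using assms(5) beta_le_alpha by auto
qed

end
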